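(* Let $T$ be a bounded linear operator on a complex Hilbert space $\mathcal H$ and let $\rho\in[1,+\infty)$. Then: (i) if $T=T^*$ then $W^\rho(T)\subseteq\mathbb R$; (ii) $W^\rho(U^*TU)=W^\rho(T)$ for any unitary operator $U$ on $\mathcal H$; (iii) $W^\rho(\alpha T)=\alpha W^\rho(T)$ for any $\alpha\in\mathbb C$; (iv) if $\mathcal K$ is a (closed, nonzero) subspace of $\mathcal H$ invariant for $T$, then $W^\rho(T|_{\mathcal K})\subseteq W^\rho(T)$; (v) $W^\rho(T)\subseteq \|T\|\,\overline{\mathbb D}$; (vi) $\sigma(T)\subseteq W^\rho(T)$, where $\sigma(T)$ is the spectrum of $T$.
   Context: $\mathbb D$ is the open unit disc in $\mathbb C$. Let $\mathcal H\neq\{0\}$ be a complex Hilbert space, $T$ a bounded linear operator on $\mathcal H$, $\rho\in[1,+\infty)$ and $r=2(1-\frac1\rho)\in[0,2)$. For $h\in\mathcal H$ with $\|h\|=1$ put $\Delta_\rho(h)=r^2|\langle Th,h\rangle|^2-4(r-1)\|Th\|^2$. For $\rho\ne 2$ let $\mathrm{dom}(\xi_\rho)=\{h\in\mathcal H:\|h\|=1,\ (\Delta_\rho(h)>0\text{ or }Th=0)\}$, and let $\mathrm{dom}(\xi_2)=\{h\in\mathcal H:\|h\|=1\}$. For $h\in\mathrm{dom}(\xi_\rho)$ let $\xi_\rho(h)=\frac12\Big(r+\frac{\sqrt{\Delta_\rho(h)}}{|\langle Th,h\rangle|}\Big)$ if $\langle Th,h\rangle\ne0$ and $\xi_\rho(h)=1$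 if $\langle Th,h\rangle=0$. The deformed numerical range of $T$ is $W^\rho(T)=\mathrm{conv}\,\overline{\{\xi_\rho(h)\langle Th,h\rangle: h\in\mathrm{dom}(\xi_\rho)\}}$. *)

theory Defs
  imports "HOL-Analysis.Analysis"
begin

section \<open>Complex Hilbert spaces\<close>

text \<open>
  The underlying real inner product is the real part of the complex one, so the norm and
  topology inherited from \<^class>\<open>real_inner\<close> are those of the complex space.
  The complex inner product is linear in its first argument.
\<close>

class complex_inner = real_inner +
  fixes scaleC :: "complex \<Rightarrow> 'a \<Rightarrow> 'a" (infixr \<open>*\<^sub>C\<close> 75)
    and cinner :: "'a \<Rightarrow> 'a \<Rightarrow> complex"
  assumes scaleC_add_right: "c *\<^sub>C (x + y) = c *\<^sub>C x + c *\<^sub>C y"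
    and scaleC_add_left: "(c + d) *\<^sub>C x = c *\<^sub>C x + d *\<^sub>C x"
    and scaleC_scaleC: "c *\<^sub>C d *\<^sub>C x = (c * d) *\<^sub>C x"
    and scaleC_of_real: "complex_of_real s *\<^sub>C x = s *\<^sub>R x"
    and cinner_add_left: "cinner (x + y) z = cinner x z + cinner y z"
    and cinner_scaleC_left: "cinner (c *\<^sub>C x) y = c * cinner x y"
    and cinner_commute: "cinner y x = cnj (cinner x y)"
    and Re_cinner: "Re (cinner x y) = inner x y"

class complex_hilbert_space = complex_inner + banach

instantiation complex :: complex_hilbert_space
begin

definition scaleC_complex :: "complex \<Rightarrow> complex \<Rightarrow> complex"
  where "scaleC_complex c x = c * x"

definition cinner_complex :: "complex \<Rightarrow> complex \<Rightarrow> complex"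
  where "cinner_complex x y = x * cnj y"

instance
  by standard
    (auto simp: scaleC_complex_def cinner_complex_def algebra_simps scaleR_conv_of_real
      inner_complex_def)

end

lemma cinner_self: "cinner x x = complex_of_real ((norm x)\<^sup>2)"
proof (rule complex_eqI)
  show "Re (cinner x x) = Re (complex_of_real ((norm x)\<^sup>2))"
    by (simp add: Re_cinner power2_norm_eq_inner)
  have "Im (cinner x x) = - Im (cinner x x)"
    using arg_cong[OF cinner_commute[of x x], of Im] by simp
  then show "Im (cinner x x) = Im (complex_of_real ((norm x)\<^sup>2))"
    by simp
qed

lemma Im_cinner: "Im (cinner x y) = inner ((- \<i>) *\<^sub>C x) y"
  by (simp add: cinner_scaleC_left flip: Re_cinner)


section \<open>Bounded operators\<close>

definition csubspace :: "'a::complex_inner set \<Rightarrow> bool"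
  where "csubspace K \<longleftrightarrow> subspace K \<and> (\<forall>c. \<forall>x\<in>K. c *\<^sub>C x \<in> K)"

definition bounded_clinear :: "('a::complex_inner \<Rightarrow> 'b::complex_inner) \<Rightarrow> bool"
  where "bounded_clinear T \<longleftrightarrow> bounded_linear T \<and> (\<forall>c x. T (c *\<^sub>C x) = c *\<^sub>C T x)"

definition cadjoint :: "('a::complex_hilbert_space \<Rightarrow> 'a) \<Rightarrow> 'a \<Rightarrow> 'a"
  where "cadjoint T = (THE S. \<forall>x y. cinner (T x) y = cinner x (S y))"

text \<open>The adjoint exists, by the Riesz representation theorem.\<close>

lemma riesz_representation:
  fixes f :: "'a::{real_inner,banach} \<Rightarrow> real"
  assumes f: "bounded_linear f"
  shows "\<exists>v. \<forall>x. f x = inner x v"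
proof -
  interpret f: bounded_linear f by (rule f)
  define q where "q x = inner x x - 2 * f x" for x
  obtain B where B: "\<And>x. \<bar>f x\<bar> \<le> norm x * B"
    using f.bounded by auto
  have q_lower: "- (B\<^sup>2) \<le> q x" for x
  proof -
    have "f x \<le> norm x * B" using B[of x] by linarith
    moreover have "0 \<le> (norm x - B)\<^sup>2" by simp
    ultimately show ?thesis
      by (simp add: q_def power2_diff flip: power2_norm_eq_inner)
  qed
  then have bdd: "bdd_below (range q)"
    by (auto intro!: bdd_belowI2[where m = "- (B\<^sup>2)"])
  define m where "m = (INF x. q x)"
  have m: "m \<le> q x" for x
    unfolding m_def using bdd by (auto intro: cINF_lower)
  have "\<exists>x. q x < m + inverse (real (Suc n))" for n
  proof -
    have "m < m + inverse (real (Suc n))" by simp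
    then show ?thesis
      unfolding m_def using bdd by (subst (asm) cINF_less_iff) auto
  qed
  then obtain X where X: "\<And>n. q (X n) < m + inverse (real (Suc n))"
    by metis
  have para: "(dist x y)\<^sup>2 \<le> 2 * (q x - m) + 2 * (q y - m)" for x y
  proof -
    have "(dist x y)\<^sup>2 = 2 * q x + 2 * q y - 4 * q ((1/2) *\<^sub>R (x + y))"
      by (simp add: q_def dist_norm power2_norm_eq_inner inner_diff inner_add inner_commute
          f.add f.scaleR algebra_simps)
    moreover have "4 * m \<le> 4 * q ((1/2) *\<^sub>R (x + y))" using m by simp
    ultimately show ?thesis by argo
  qed
  have "Cauchy X"
  proof (rule metric_CauchyI)
    fix e :: real assume "e > 0"
    then obtain N where N: "inverse (real (Suc N)) < e\<^sup>2 / 4"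
      using reals_Archimedean[of "e\<^sup>2 / 4"] by auto
    have "dist (X k) (X l) < e" if "k \<ge> N" "l \<ge> N" for k l
    proof -
      have "inverse (real (Suc k)) \<le> inverse (real (Suc N))"
        and "inverse (real (Suc l)) \<le> inverse (real (Suc N))"
        using that by (auto intro!: le_imp_inverse_le)
      then have "(dist (X k) (X l))\<^sup>2 < e\<^sup>2"
        using para[of "X k" "X l"] X[of k] X[of l] N by argo
      then show ?thesis using \<open>e > 0\<close> by (auto intro: power_less_imp_less_base)
    qed
    then show "\<exists>M. \<forall>k\<ge>M. \<forall>l\<ge>M. dist (X k) (X l) < e" by blast
  qed
  then obtain v where v: "X \<longlonglongrightarrow> v"
    using Cauchy_convergent convergent_def by blast
  have "(\<lambda>n. q (X n)) \<longlonglongrightarrow> q v"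
    unfolding q_def by (intro tendsto_intros v f.tendsto)
  moreover have "(\<lambda>n. m + inverse (real (Suc n))) \<longlonglongrightarrow> m + 0"
    by (intro tendsto_intros LIMSEQ_inverse_real_of_nat)
  ultimately have "q v \<le> m"
    using X by (auto intro: LIMSEQ_le less_imp_le)
  then have min: "q v \<le> q x" for x using m[of x] by linarith
  have "f x = inner x v" for x
  proof (rule ccontr)
    define d where "d = f x - inner x v"
    assume "f x \<noteq> inner x v"
    then have d: "d \<noteq> 0" and "x \<noteq> 0" by (auto simp: d_def)
    then have xx: "inner x x > 0" by simp
    define t where "t = d / inner x x"
    have "q (v + t *\<^sub>R x) = q v + t * (t * inner x x) - 2 * t * d"
      by (simp add: q_def d_def inner_add inner_commute f.add f.scaleR algebra_simps)
    also have "t * inner x x = d" using xx by (simp add: t_def)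
    finally have "t * d \<le> 0" using min[of "v + t *\<^sub>R x"] by linarith
    moreover have "t * d > 0" using d xx by (simp add: t_def flip: power2_eq_square)
    ultimately show False by simp
  qed
  then show ?thesis by blast
qed

lemma cinner_cadjoint:
  assumes T: "bounded_clinear T"
  shows "cinner (T x) y = cinner x (cadjoint T y)"
proof -
  have bl: "bounded_linear T" and sc: "\<And>c x. T (c *\<^sub>C x) = c *\<^sub>C T x"
    using T by (auto simp: bounded_clinear_def)
  have "\<forall>y. \<exists>v. \<forall>x. inner (T x) y = inner x v"
    by (intro allI riesz_representation
        bounded_linear_compose[OF bounded_linear_inner_left bl])
  then obtain S where S: "\<And>x y. inner (T x) y = inner x (S y)" by metis
  have "cinner (T x) y = cinner x (S y)" for x y
    by (rule complex_eqI) (simp_all only: Re_cinner Im_cinner S flip: sc)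
  moreover have "S' = S" if "\<forall>x y. cinner (T x) y = cinner x (S' y)" for S'
  proof
    fix y
    have "inner x (S' y) = inner x (S y)" for x
      using that S by (metis Re_cinner)
    then show "S' y = S y" using vector_eq_ldot by blast
  qed
  ultimately have "cadjoint T = S"
    unfolding cadjoint_def by (intro the_equality) blast+
  with \<open>\<And>x y. cinner (T x) y = cinner x (S y)\<close> show ?thesis by simp
qed

definition unitary_op :: "('a::complex_hilbert_space \<Rightarrow> 'a) \<Rightarrow> bool"
  where "unitary_op U \<longleftrightarrow>
    bounded_clinear U \<and> cadjoint U \<circ> U = id \<and> U \<circ> cadjoint U = id"

definition op_spectrum :: "('a::complex_hilbert_space \<Rightarrow> 'a) \<Rightarrow> complex set"
  where "op_spectrum T =
    {z. \<not> (\<exists>S. bounded_clinear S \<and>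
          S \<circ> (\<lambda>x. T x - z *\<^sub>C x) = id \<and> (\<lambda>x. T x - z *\<^sub>C x) \<circ> S = id)}"


section \<open>The deformed numerical range\<close>

definition def_r :: "real \<Rightarrow> real"
  where "def_r \<rho> = 2 * (1 - 1 / \<rho>)"

definition def_Delta :: "real \<Rightarrow> ('a::complex_inner \<Rightarrow> 'a) \<Rightarrow> 'a \<Rightarrow> real"
  where "def_Delta \<rho> T h =
    (def_r \<rho>)\<^sup>2 * (cmod (cinner (T h) h))\<^sup>2 - 4 * (def_r \<rho> - 1) * (norm (T h))\<^sup>2"

text \<open>
  The argument \<open>K\<close> is the space on which the operator is considered: a subspace
  invariant under \<open>T\<close>, for the restriction of \<open>T\<close> to \<open>K\<close>, or the whole
  space. Only the values of \<open>T\<close> on \<open>K\<close> matter.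
\<close>

definition xi_dom :: "real \<Rightarrow> 'a::complex_inner set \<Rightarrow> ('a \<Rightarrow> 'a) \<Rightarrow> 'a set"
  where "xi_dom \<rho> K T =
    (if \<rho> = 2 then {h \<in> K. norm h = 1}
     else {h \<in> K. norm h = 1 \<and> (def_Delta \<rho> T h > 0 \<or> T h = 0)})"

definition xi :: "real \<Rightarrow> ('a::complex_inner \<Rightarrow> 'a) \<Rightarrow> 'a \<Rightarrow> real"
  where "xi \<rho> T h =
    (if cinner (T h) h \<noteq> 0
     then (1 / 2) * (def_r \<rho> + sqrt (def_Delta \<rho> T h) / cmod (cinner (T h) h))
     else 1)"

definition deformed_range_on :: "real \<Rightarrow> 'a::complex_inner set \<Rightarrow> ('a \<Rightarrow> 'a) \<Rightarrow> complex set"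
  where "deformed_range_on \<rho> K T =
    convex hull (closure ((\<lambda>h. complex_of_real (xi \<rho> T h) * cinner (T h) h) ` xi_dom \<rho> K T))"

abbreviation deformed_range :: "real \<Rightarrow> ('a::complex_inner \<Rightarrow> 'a) \<Rightarrow> complex set"
  where "deformed_range \<rho> T \<equiv> deformed_range_on \<rho> UNIV T"

end

theory Submission
  imports Defs "HOL-Complex_Analysis.Complex_Analysis"
begin

text \<open>
  The substantial part is the spectral inclusion. A frontier point of the spectrum is an approximate
  eigenvalue; if it is nonzero, it is a limit of values \<open>\<xi>\<^sub>\<rho>(h)\<langle>Th,h\<rangle>\<close> along approximate
  eigenvectors, because \<open>\<Delta>\<^sub>\<rho>(h)\<close> tends to \<open>(2-r)\<^sup>2|z|\<^sup>2 > 0\<close>. At \<open>z = 0\<close> the domain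
  of \<open>\<xi>\<^sub>\<rho>\<close> may miss the approximate eigenvectors; but then \<open>|\<lambda>|\<close> times the norm of the resolvent
  stays bounded near \<open>0\<close>, and as \<open>T\<close> is injective the singularity of the resolvent is removable.
  The deformed range is compact and convex, so it contains the spectrum once it contains its frontier.
\<close>

section \<open>Complex inner products\<close>

lemma cinner_add_right: "cinner x (y + z) = cinner x y + cinner x z"
  by (metis cinner_add_left cinner_commute complex_cnj_add)

lemma cinner_scaleC_right: "cinner x (c *\<^sub>C y) = cnj c * cinner x y"
  by (metis cinner_scaleC_left cinner_commute complex_cnj_mult)

lemma scaleC_zero_left [simp]: "0 *\<^sub>C x = 0"
  using scaleC_of_real[of 0 x] by simp

lemma scaleC_one [simp]: "1 *\<^sub>C x = x"
  using scaleC_of_real[of 1 x] by simp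

lemma scaleC_minus1: "(-1) *\<^sub>C x = - x"
  using scaleC_of_real[of "-1" x] by simp

lemma scaleC_zero_right [simp]: "c *\<^sub>C (0::'a::complex_inner) = 0"
  using scaleC_add_right[of c "0::'a" 0] by simp

lemma scaleC_minus_right: "c *\<^sub>C (- x) = - (c *\<^sub>C x)"
  by (metis add_eq_0_iff scaleC_add_right scaleC_zero_right)

lemma scaleC_minus_left: "(- c) *\<^sub>C x = - (c *\<^sub>C x)"
  by (metis scaleC_minus1 scaleC_scaleC mult_minus1)

lemma scaleC_diff_right: "c *\<^sub>C (x - y) = c *\<^sub>C x - c *\<^sub>C y"
  using scaleC_add_right[of c x "- y"] by (simp add: scaleC_minus_right)

lemma scaleC_diff_left: "(c - d) *\<^sub>C x = c *\<^sub>C x - d *\<^sub>C x"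
  using scaleC_add_left[of c "- d" x] by (simp add: scaleC_minus_left)

lemma cinner_zero_left [simp]: "cinner 0 y = 0"
  using cinner_scaleC_left[of 0 0 y] by simp

lemma cinner_minus_left: "cinner (- x) y = - cinner x y"
  using cinner_scaleC_left[of "-1" x y] by (simp add: scaleC_minus1)

lemma cinner_diff_left: "cinner (x - y) z = cinner x z - cinner y z"
  using cinner_add_left[of x "- y" z] by (simp add: cinner_minus_left)

lemma cinner_scaleR_right: "cinner x (s *\<^sub>R y) = of_real s * cinner x y"
  using cinner_scaleC_right[of x "of_real s" y] by (simp add: scaleC_of_real)

text \<open>The class axioms tie the norm to real scalars only. The modulus of a complex scalar
  enters through \<open>cinner_self\<close>, where it appears squared as
  \<open>c * cnj c\<close>.\<close>

lemma norm_scaleC: "norm (c *\<^sub>C x) = cmod c * norm x"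
proof -
  have "complex_of_real ((norm (c *\<^sub>C x))\<^sup>2) = c * cnj c * complex_of_real ((norm x)\<^sup>2)"
    unfolding cinner_self[symmetric] by (simp add: cinner_scaleC_left cinner_scaleC_right)
  also have "\<dots> = complex_of_real ((cmod c * norm x)\<^sup>2)"
    by (simp add: power_mult_distrib complex_norm_square[symmetric] flip: of_real_power)
  finally show ?thesis
    unfolding of_real_eq_iff by (subst (asm) power2_eq_iff_nonneg) auto
qed

text \<open>The real Cauchy-Schwarz inequality controls the real part. Multiplying \<open>x\<close>
  by the unimodular \<open>c\<close> rotates the complex inner product onto the positive real axis
  and keeps the norm of \<open>x\<close>.\<close>

lemma cmod_cinner_le: "cmod (cinner x y) \<le> norm x * norm y"
proof (cases "cinner x y = 0")
  case False
  define c where "c = cnj (cinner x y) / cmod (cinner x y)"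
  have "c * cinner x y = cmod (cinner x y)"
    using False
    by (simp add: c_def complex_norm_square[symmetric] mult.commute power2_eq_square field_simps)
  then have "cmod (cinner x y) = inner (c *\<^sub>C x) y"
    unfolding Re_cinner[symmetric] cinner_scaleC_left by simp
  also have "\<dots> \<le> norm (c *\<^sub>C x) * norm y" by (rule norm_cauchy_schwarz)
  also have "norm (c *\<^sub>C x) = norm x"
    using False by (simp add: norm_scaleC c_def norm_divide)
  finally show ?thesis .
qed simp

lemma bounded_clinear_simps:
  assumes "bounded_clinear T"
  shows "T (x + y) = T x + T y" "T (x - y) = T x - T y" "T (c *\<^sub>C x) = c *\<^sub>C T x"
    "T 0 = 0" "T (s *\<^sub>R x) = s *\<^sub>R T x" "bounded_linear T"
proof -
  show bl: "bounded_linear T" and "T (c *\<^sub>C x) = c *\<^sub>C T x"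
    using assms by (auto simp: bounded_clinear_def)
  interpret bounded_linear T by (rule bl)
  show "T (x + y) = T x + T y" "T (x - y) = T x - T y" "T 0 = 0" "T (s *\<^sub>R x) = s *\<^sub>R T x"
    by (simp_all add: add diff scaleR)
qed

lemma bounded_clinear_shift:
  assumes "bounded_clinear T"
  shows "bounded_clinear (\<lambda>x. T x - z *\<^sub>C x)"
proof -
  note T = bounded_clinear_simps[OF assms]
  have "bounded_linear (\<lambda>x. z *\<^sub>C x)"
    by (rule bounded_linear_intro[where K = "cmod z"])
      (simp_all add: scaleC_add_right norm_scaleC scaleC_scaleC mult.commute
        flip: scaleC_of_real)
  then show ?thesis
    by (auto simp: bounded_clinear_def T scaleC_diff_right scaleC_scaleC mult.commute
        intro!: bounded_linear_sub)
qed

section \<open>Resolvent set and resolvent\<close>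

text \<open>The sign of \<open>k\<close> is left free, so that moving from \<open>z\<close> to
  \<open>w\<close> simply lowers the constant by \<open>cmod (w - z)\<close>. Positivity is asked
  for where injectivity or a resolvent bound is drawn from it.\<close>

definition bdd_below_by :: "real \<Rightarrow> ('a::complex_inner \<Rightarrow> 'a) \<Rightarrow> complex \<Rightarrow> bool"
  where "bdd_below_by k T z \<longleftrightarrow> (\<forall>h. k * norm h \<le> norm (T h - z *\<^sub>C h))"

lemma bdd_below_by_perturb:
  assumes "bdd_below_by k T z"
  shows "bdd_below_by (k - cmod (w - z)) T w"
  unfolding bdd_below_by_def
proof
  fix h
  have "T h - z *\<^sub>C h = (T h - w *\<^sub>C h) + (w - z) *\<^sub>C h"
    by (simp add: scaleC_diff_left)
  then have "norm (T h - z *\<^sub>C h) \<le> norm (T h - w *\<^sub>C h) + cmod (w - z) * norm h"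
    by (metis norm_triangle_ineq norm_scaleC)
  then show "(k - cmod (w - z)) * norm h \<le> norm (T h - w *\<^sub>C h)"
    using assms unfolding bdd_below_by_def by (smt (verit) left_diff_distrib)
qed

lemma inj_if_bdd_below_by:
  assumes "bounded_clinear T" "bdd_below_by k T z" "k > 0"
  shows "inj (\<lambda>x. T x - z *\<^sub>C x)"
proof (rule injI)
  fix x y assume "T x - z *\<^sub>C x = T y - z *\<^sub>C y"
  then have "T (x - y) - z *\<^sub>C (x - y) = 0"
    by (simp add: bounded_clinear_simps[OF assms(1)] scaleC_diff_right algebra_simps)
  then have "k * norm (x - y) \<le> 0" using assms(2) unfolding bdd_below_by_def by (metis norm_zero)
  then show "x = y" using \<open>k > 0\<close> by (simp add: mult_le_0_iff)
qed

text \<open>A positive lower bound supplies injectivity and the norm bound \<open>1 / k\<close> of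
  the inverse at once; surjectivity makes that inverse defined everywhere. Conversely, a norm bound
  of the inverse is a lower bound read backwards.\<close>

lemma notin_op_spectrum_iff:
  fixes T :: "'a::complex_hilbert_space \<Rightarrow> 'a"
  assumes T: "bounded_clinear T"
  shows "z \<notin> op_spectrum T \<longleftrightarrow>
    (\<exists>k>0. bdd_below_by k T z) \<and> surj (\<lambda>x. T x - z *\<^sub>C x)"
    (is "?L \<longleftrightarrow> ?R")
proof
  assume ?L
  then obtain S where S: "bounded_clinear S" "\<And>x. S (T x - z *\<^sub>C x) = x"
      "\<And>x. T (S x) - z *\<^sub>C S x = x"
    by (auto simp: op_spectrum_def fun_eq_iff)
  obtain K where K: "K > 0" "\<And>x. norm (S x) \<le> norm x * K"
    using bounded_linear.pos_bounded bounded_clinear_simps(6)[OF S(1)] by blast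
  have "bdd_below_by (1 / K) T z"
    unfolding bdd_below_by_def
  proof
    fix h
    have "norm h \<le> norm (T h - z *\<^sub>C h) * K" using K(2)[of "T h - z *\<^sub>C h"] S(2) by simp
    then show "1 / K * norm h \<le> norm (T h - z *\<^sub>C h)" using K(1) by (simp add: field_simps)
  qed
  moreover have "surj (\<lambda>x. T x - z *\<^sub>C x)" using S(3) by (metis surjI)
  ultimately show ?R using K(1) by (metis zero_less_divide_1_iff)
next
  assume ?R
  then obtain k where k: "k > 0" "bdd_below_by k T z" and su: "surj (\<lambda>x. T x - z *\<^sub>C x)"
    by blast
  let ?A = "\<lambda>x. T x - z *\<^sub>C x"
  have inj: "inj ?A" using inj_if_bdd_below_by[OF T k(2,1)] .
  define S where "S = inv ?A"
  have AS: "?A (S x) = x" for x unfolding S_def using surj_f_inv_f[OF su] .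
  have SA: "S (?A x) = x" for x unfolding S_def using inv_f_f[OF inj] .
  note A = bounded_clinear_simps[OF bounded_clinear_shift[OF T, of z]]
  have "S (x + y) = S x + S y" for x y
    using A(1)[of "S x" "S y"] AS SA by metis
  moreover have sc: "S (c *\<^sub>C x) = c *\<^sub>C S x" for c x
    using A(3)[of c "S x"] AS SA by metis
  moreover have "norm (S x) \<le> norm x * (1 / k)" for x
    using k AS[of x] unfolding bdd_below_by_def by (metis divide_inverse inverse_eq_divide
        mult.commute pos_le_divide_eq)
  ultimately have "bounded_clinear S"
    unfolding bounded_clinear_def
    by (auto intro!: bounded_linear_intro[where K = "1 / k"] simp flip: scaleC_of_real)
  then show ?L unfolding op_spectrum_def using AS SA by (auto simp: fun_eq_iff)
qed

text \<open>Solutions of \<open>T y - w *\<^sub>C y = x\<close> are the fixed points of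
  \<open>F\<close>, a contraction with factor \<open>cmod (w - z) / k\<close>. The lower bound
  itself is thus the radius of a disc of resolvent points, so a good bound at a nearby point can
  reach a point in question.\<close>

lemma notin_op_spectrum_perturb:
  fixes T :: "'a::complex_hilbert_space \<Rightarrow> 'a"
  assumes T: "bounded_clinear T" and z: "z \<notin> op_spectrum T"
    and k: "bdd_below_by k T z" and w: "cmod (w - z) < k"
  shows "w \<notin> op_spectrum T"
proof -
  let ?A = "\<lambda>x. T x - z *\<^sub>C x"
  have k0: "k > 0" using w by (smt (verit) norm_ge_zero)
  have su: "surj ?A" using z notin_op_spectrum_iff[OF T] by blast
  have AS: "?A (inv ?A x) = x" for x using surj_f_inv_f[OF su] .
  note A = bounded_clinear_simps[OF bounded_clinear_shift[OF T, of z]]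
  have "surj (\<lambda>x. T x - w *\<^sub>C x)"
  unfolding surj_def
  proof
    fix x
    define F where "F y = inv ?A (x + (w - z) *\<^sub>C y)" for y
    have AF: "?A (F y) = x + (w - z) *\<^sub>C y" for y unfolding F_def by (rule AS)
    have "\<exists>!y. F y = y"
    proof (rule banach_fix_type[of "cmod (w - z) / k"])
      show "\<forall>y y'. dist (F y) (F y') \<le> cmod (w - z) / k * dist y y'"
      proof (intro allI)
        fix y y'
        have "k * norm (F y - F y') \<le> norm (?A (F y - F y'))"
          using k unfolding bdd_below_by_def by blast
        also have "?A (F y - F y') = (w - z) *\<^sub>C (y - y')"
          unfolding A(2) AF by (simp add: scaleC_diff_right)
        finally show "dist (F y) (F y') \<le> cmod (w - z) / k * dist y y'"
          using k0 by (simp add: dist_norm norm_scaleC field_simps)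
      qed
    qed (use k0 w in auto)
    then obtain y where "F y = y" by blast
    then have "T y - w *\<^sub>C y = x" using AF[of y] by (simp add: scaleC_diff_left algebra_simps)
    then show "\<exists>y. x = T y - w *\<^sub>C y" by blast
  qed
  moreover have "bdd_below_by (k - cmod (w - z)) T w" by (rule bdd_below_by_perturb[OF k])
  ultimately show ?thesis using w notin_op_spectrum_iff[OF T] by (metis diff_gt_0_iff_gt)
qed

text \<open>Division by \<open>z\<close> turns the equation into a fixed point problem for a
  contraction with factor \<open>onorm T / cmod z\<close>. The explicit lower bound later makes the
  resolvent vanish at infinity.\<close>

lemma notin_op_spectrum_large:
  fixes T :: "'a::complex_hilbert_space \<Rightarrow> 'a"
  assumes T: "bounded_clinear T" and z: "onorm T < cmod z"
  shows "z \<notin> op_spectrum T" "bdd_below_by (cmod z - onorm T) T z"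
proof -
  note Ts = bounded_clinear_simps[OF T]
  have on: "norm (T x) \<le> onorm T * norm x" for x by (rule onorm[OF Ts(6)])
  have z0: "z \<noteq> 0" using z onorm_pos_le[OF Ts(6)] by auto
  show b: "bdd_below_by (cmod z - onorm T) T z"
    unfolding bdd_below_by_def
  proof
    fix h
    have "cmod z * norm h \<le> norm (T h - z *\<^sub>C h) + norm (T h)"
      by (metis norm_scaleC norm_minus_commute norm_triangle_sub add.commute)
    then show "(cmod z - onorm T) * norm h \<le> norm (T h - z *\<^sub>C h)"
      using on[of h] by (simp add: algebra_simps)
  qed
  have "surj (\<lambda>x. T x - z *\<^sub>C x)"
  unfolding surj_def
  proof
    fix x
    define F where "F y = (1 / z) *\<^sub>C (T y - x)" for y
    have "\<exists>!y. F y = y"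
    proof (rule banach_fix_type[of "onorm T / cmod z"])
      show "\<forall>y y'. dist (F y) (F y') \<le> onorm T / cmod z * dist y y'"
      proof (intro allI)
        fix y y'
        have "F y - F y' = (1 / z) *\<^sub>C T (y - y')"
          unfolding F_def by (simp add: Ts flip: scaleC_diff_right)
        then have "norm (F y - F y') = norm (T (y - y')) / cmod z"
          by (simp add: norm_scaleC norm_divide)
        then show "dist (F y) (F y') \<le> onorm T / cmod z * dist y y'"
          using on[of "y - y'"] z0 by (simp add: dist_norm divide_right_mono)
      qed
    qed (use z z0 onorm_pos_le[OF Ts(6)] in auto)
    then obtain y where "F y = y" by blast
    then have "z *\<^sub>C y = T y - x" unfolding F_def using z0
      by (metis scaleC_scaleC scaleC_one nonzero_mult_div_cancel_left times_divide_eq_right mult.right_neutral)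
    then have "T y - z *\<^sub>C y = x" by simp
    then show "\<exists>y. x = T y - z *\<^sub>C y" by blast
  qed
  then show "z \<notin> op_spectrum T" using b z notin_op_spectrum_iff[OF T] by (metis diff_gt_0_iff_gt)
qed

section \<open>Compactness of the spectrum and approximate eigenvalues on its frontier\<close>

lemma closed_op_spectrum:
  fixes T :: "'a::complex_hilbert_space \<Rightarrow> 'a"
  assumes T: "bounded_clinear T"
  shows "closed (op_spectrum T)"
  unfolding closed_def open_contains_ball
proof
  fix z assume "z \<in> - op_spectrum T"
  then obtain k where "k > 0" "bdd_below_by k T z" "z \<notin> op_spectrum T"
    using notin_op_spectrum_iff[OF T] by blast
  then show "\<exists>e>0. ball z e \<subseteq> - op_spectrum T"
    using notin_op_spectrum_perturb[OF T] by (metis ComplI mem_ball dist_commute dist_norm subsetI)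
qed

lemma compact_op_spectrum:
  fixes T :: "'a::complex_hilbert_space \<Rightarrow> 'a"
  assumes T: "bounded_clinear T"
  shows "compact (op_spectrum T)"
proof -
  have "op_spectrum T \<subseteq> cball 0 (onorm T)"
    using notin_op_spectrum_large(1)[OF T] by (auto simp: not_less[symmetric])
  then show ?thesis
    using closed_op_spectrum[OF T] bounded_subset bounded_cball compact_eq_bounded_closed by blast
qed

text \<open>A lower bound at \<open>z\<close> would persist at a resolvent point \<open>w\<close>
  close by, and the disc of resolvent points that it gives around \<open>w\<close> would contain
  \<open>z\<close>, which belongs to the closed spectrum.\<close>

lemma frontier_op_spectrum_approx:
  fixes T :: "'a::complex_hilbert_space \<Rightarrow> 'a"
  assumes T: "bounded_clinear T" and z: "z \<in> frontier (op_spectrum T)"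
  shows "\<not> (\<exists>k>0. bdd_below_by k T z)"
proof
  assume "\<exists>k>0. bdd_below_by k T z"
  then obtain k where k: "k > 0" "bdd_below_by k T z" by blast
  have "z \<in> closure (- op_spectrum T)" and zs: "z \<in> op_spectrum T"
    using z frontier_subset_closed[OF closed_op_spectrum[OF T]] by (auto simp: frontier_closures)
  \<comment> \<open>Any radius up to \<open>k / 2\<close> serves: what counts is
    \<open>cmod (w - z) < k - cmod (w - z)\<close>.\<close>
  then obtain w where w: "w \<notin> op_spectrum T" "dist w z < k / 3"
    using k(1) unfolding closure_approachable by (metis ComplD divide_pos_pos zero_less_numeral)
  then have "cmod (z - w) < k - cmod (w - z)"
    using k(1) unfolding dist_norm norm_minus_commute[of z w] by linarith
  then show False
    using notin_op_spectrum_perturb[OF T w(1) bdd_below_by_perturb[OF k(2)]] zs by blast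
qed

section \<open>The resolvent as a weakly holomorphic function\<close>

definition resolvent :: "('a::complex_hilbert_space \<Rightarrow> 'a) \<Rightarrow> complex \<Rightarrow> 'a \<Rightarrow> 'a"
  where "resolvent T z = inv (\<lambda>x. T x - z *\<^sub>C x)"

lemma resolvent_right:
  assumes "bounded_clinear T" "z \<notin> op_spectrum T"
  shows "T (resolvent T z x) - z *\<^sub>C resolvent T z x = x"
  using assms notin_op_spectrum_iff unfolding resolvent_def
  by (metis (mono_tags, lifting) surj_f_inv_f)

lemma resolvent_bound:
  assumes "bounded_clinear T" "z \<notin> op_spectrum T" "bdd_below_by k T z" "k > 0"
  shows "norm (resolvent T z x) \<le> norm x / k"
  using assms(3,4) resolvent_right[OF assms(1,2), of x] unfolding bdd_below_by_def
  by (metis pos_le_divide_eq mult.commute)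

lemma resolvent_unique:
  assumes "bounded_clinear T" "z \<notin> op_spectrum T" "T y - z *\<^sub>C y = x"
  shows "resolvent T z x = y"
proof -
  obtain k where "k > 0" "bdd_below_by k T z" using assms notin_op_spectrum_iff by blast
  then have "inj (\<lambda>x. T x - z *\<^sub>C x)" using inj_if_bdd_below_by assms(1) by blast
  then show ?thesis using assms(3) unfolding resolvent_def by (metis (no_types, lifting) inv_f_f)
qed

lemma resolvent_left:
  assumes "bounded_clinear T" "z \<notin> op_spectrum T"
  shows "resolvent T z (T x - z *\<^sub>C x) = x"
  using resolvent_unique[OF assms] by blast

lemma resolvent_identity:
  assumes T: "bounded_clinear T" and z: "z \<notin> op_spectrum T" and w: "w \<notin> op_spectrum T"
  shows "resolvent T w x - resolvent T z x = (w - z) *\<^sub>C resolvent T w (resolvent T z x)"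
proof -
  note Ts = bounded_clinear_simps[OF T]
  let ?u = "resolvent T z x" and ?v = "resolvent T w (resolvent T z x)"
  have "resolvent T w x = ?u + (w - z) *\<^sub>C ?v"
  proof (rule resolvent_unique[OF T w])
    have "T (?u + (w - z) *\<^sub>C ?v) - w *\<^sub>C (?u + (w - z) *\<^sub>C ?v)
        = (T ?u - w *\<^sub>C ?u) + (w - z) *\<^sub>C (T ?v - w *\<^sub>C ?v)"
      by (simp add: Ts scaleC_add_right scaleC_diff_right scaleC_scaleC mult.commute)
    also have "\<dots> = T ?u - z *\<^sub>C ?u"
      unfolding resolvent_right[OF T w] by (simp add: scaleC_diff_left)
    finally show "T (?u + (w - z) *\<^sub>C ?v) - w *\<^sub>C (?u + (w - z) *\<^sub>C ?v) = x"
      unfolding resolvent_right[OF T z] .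
  qed
  then show ?thesis by simp
qed

text \<open>Scalar coefficients bring the resolvent within reach of complex analysis in one
  variable. The resolvent identity rewrites the difference quotient as
  \<open>cinner (resolvent T w ?u) y\<close>; applied once more, it shows that this differs from its
  value at \<open>w = z\<close> by at most a constant times \<open>cmod (w - z)\<close>.\<close>

lemma holomorphic_cinner_resolvent:
  fixes T :: "'a::complex_hilbert_space \<Rightarrow> 'a"
  assumes T: "bounded_clinear T"
  shows "(\<lambda>z. cinner (resolvent T z x) y) holomorphic_on - op_spectrum T"
proof -
  have op: "open (- op_spectrum T)" using closed_op_spectrum[OF T] by auto
  have "((\<lambda>z. cinner (resolvent T z x) y) has_field_derivative
      cinner (resolvent T z (resolvent T z x)) y) (at z)"
    if z: "z \<in> - op_spectrum T" for z
    unfolding has_field_derivative_iff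
  proof -
    obtain k where k: "k > 0" "bdd_below_by k T z" using z notin_op_spectrum_iff[OF T] by blast
    let ?u = "resolvent T z x"
    \<comment> \<open>Within \<open>k / 2\<close> of \<open>z\<close> the lower bound stays above
      \<open>k / 2\<close>, so these resolvents share the bound \<open>2 / k\<close>.\<close>
    have ev: "eventually (\<lambda>w. w \<notin> op_spectrum T \<and> cmod (w - z) < k / 2) (at z)"
    proof (rule eventually_conj)
      show "eventually (\<lambda>w. w \<notin> op_spectrum T) (at z)"
        using eventually_at_in_open'[OF op z] by simp
      show "eventually (\<lambda>w. cmod (w - z) < k / 2) (at z)"
        using k(1) eventually_at_ball[of "k / 2" z UNIV]
        by (simp add: dist_norm norm_minus_commute)
    qed
    have "((\<lambda>w. cinner (resolvent T w ?u) y - cinner (resolvent T z ?u) y) \<longlongrightarrow> 0) (at z)"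
    proof (rule Lim_null_comparison)
      let ?C = "2 / k * norm (resolvent T z ?u) * norm y"
      show "eventually (\<lambda>w. norm (cinner (resolvent T w ?u) y - cinner (resolvent T z ?u) y)
          \<le> cmod (w - z) * ?C) (at z)"
        using ev
      proof eventually_elim
        case (elim w)
        then have w: "w \<notin> op_spectrum T" and wk: "cmod (w - z) < k / 2" by auto
        have "norm (resolvent T w (resolvent T z ?u))
            \<le> norm (resolvent T z ?u) / (k - cmod (w - z))"
          by (rule resolvent_bound[OF T w bdd_below_by_perturb[OF k(2)]]) (use wk k in auto)
        also have "\<dots> \<le> norm (resolvent T z ?u) / (k / 2)"
          by (rule divide_left_mono) (use wk k in auto)
        finally have *: "norm (resolvent T w (resolvent T z ?u))
          \<le> 2 / k * norm (resolvent T z ?u)" by (simp add: field_simps)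
        have "norm (cinner (resolvent T w ?u) y - cinner (resolvent T z ?u) y)
          = cmod (w - z) * cmod (cinner (resolvent T w (resolvent T z ?u)) y)"
          using z by (simp add: resolvent_identity[OF T _ w] cinner_scaleC_left norm_mult
              flip: cinner_diff_left)
        also have "\<dots> \<le> cmod (w - z) * (norm (resolvent T w (resolvent T z ?u)) * norm y)"
          by (intro mult_left_mono cmod_cinner_le) auto
        also have "\<dots> \<le> cmod (w - z) * ?C"
          by (intro mult_left_mono mult_right_mono *) auto
        finally show ?case .
      qed
      have "((\<lambda>w. cmod (w - z) * ?C) \<longlongrightarrow> cmod (z - z) * ?C) (at z)"
        by (intro tendsto_intros)
      then show "((\<lambda>w. cmod (w - z) * ?C) \<longlongrightarrow> 0) (at z)" by simp
    qed
    then have lim: "((\<lambda>w. cinner (resolvent T w ?u) y) \<longlongrightarrow> cinner (resolvent T z ?u) y) (at z)"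
      by (rule LIM_zero_cancel)
    show "((\<lambda>w. (cinner (resolvent T w x) y - cinner ?u y) / (w - z))
        \<longlongrightarrow> cinner (resolvent T z ?u) y) (at z)"
    proof (rule Lim_transform_eventually[OF lim])
      show "eventually (\<lambda>w. cinner (resolvent T w ?u) y
          = (cinner (resolvent T w x) y - cinner ?u y) / (w - z)) (at z)"
        using ev eventually_neq_at_within[of z z UNIV]
      proof eventually_elim
        case (elim w)
        then show ?case
          using z by (simp add: resolvent_identity[OF T] cinner_scaleC_left flip: cinner_diff_left)
      qed
    qed
  qed
  then show ?thesis using op by (auto simp: holomorphic_on_open)
qed

text \<open>With empty spectrum every coefficient of the resolvent is entire and tends to 0 at
  infinity, hence vanishes by Liouville's theorem.\<close>

theorem op_spectrum_nonempty:
  fixes T :: "'a::complex_hilbert_space \<Rightarrow> 'a"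
  assumes T: "bounded_clinear T" and ne: "(UNIV :: 'a set) \<noteq> {0}"
  shows "op_spectrum T \<noteq> {}"
proof
  assume emp: "op_spectrum T = {}"
  obtain x :: 'a where x: "x \<noteq> 0" using ne by auto
  \<comment> \<open>This choice makes the coefficient at 0 equal to the squared norm of
    \<open>y\<close>.\<close>
  define y where "y = resolvent T 0 x"
  have "((\<lambda>z. cinner (resolvent T z x) y) \<longlongrightarrow> 0) at_infinity"
  proof (rule Lim_null_comparison)
    show "eventually (\<lambda>z. norm (cinner (resolvent T z x) y)
        \<le> norm x * norm y / (cmod z - onorm T)) at_infinity"
      unfolding eventually_at_infinity
    proof (intro exI allI impI)
      fix z assume "onorm T + 1 \<le> cmod z"
      then have z: "onorm T < cmod z" by simp
      have "norm (cinner (resolvent T z x) y) \<le> norm (resolvent T z x) * norm y"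
        by (rule cmod_cinner_le)
      also have "\<dots> \<le> norm x / (cmod z - onorm T) * norm y"
        using z by (intro mult_right_mono resolvent_bound T notin_op_spectrum_large) auto
      finally show "norm (cinner (resolvent T z x) y) \<le> norm x * norm y / (cmod z - onorm T)"
        by simp
    qed
    show "((\<lambda>z. norm x * norm y / (cmod z - onorm T)) \<longlongrightarrow> 0) at_infinity"
    proof (rule tendsto_divide_0[OF tendsto_const])
      have "filterlim (\<lambda>z::complex. - onorm T + norm z) at_top at_infinity"
        by (rule filterlim_tendsto_add_at_top[OF tendsto_const filterlim_norm_at_top])
      then show "filterlim (\<lambda>z::complex. norm z - onorm T) at_infinity at_infinity"
        by (intro filterlim_at_top_imp_at_infinity) (simp add: algebra_simps)
    qed
  qed
  then have "cinner (resolvent T 0 x) y = 0"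
    by (rule Liouville_weak[rotated]) (use holomorphic_cinner_resolvent[OF T] emp in simp)
  then have "y = 0" by (simp add: y_def cinner_self)
  then show False
    using resolvent_right[OF T, of 0 x] x emp by (simp add: y_def bounded_clinear_simps[OF T])
qed

text \<open>The lower bound allows at most a simple pole at 0. Once the residue is shown to vanish,
  the maximum modulus principle bounds the resolvent near 0 by a constant \<open>M\<close>, and the
  disc of radius \<open>1 / M\<close> around a resolvent point close to 0 contains 0.\<close>

lemma resolvent_pole_extends:
  fixes T :: "'a::complex_hilbert_space \<Rightarrow> 'a"
  assumes T: "bounded_clinear T" and inj: "\<And>h. T h = 0 \<Longrightarrow> h = 0"
    and "\<kappa> > 0" "\<delta> > 0"
    and res: "\<And>z. 0 < cmod z \<Longrightarrow> cmod z < \<delta> \<Longrightarrow> z \<notin> op_spectrum T"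
    and below: "\<And>z. 0 < cmod z \<Longrightarrow> cmod z < \<delta> \<Longrightarrow> bdd_below_by (\<kappa> * cmod z) T z"
  shows "0 \<notin> op_spectrum T"
proof -
  note Ts = bounded_clinear_simps[OF T]
  define f where "f x y z = cinner (resolvent T z x) y" for x y z
  let ?B = "ball 0 \<delta> :: complex set"
  have hol: "f x y holomorphic_on ?B - {0}" for x y
    unfolding f_def by (rule holomorphic_on_subset[OF holomorphic_cinner_resolvent[OF T]])
      (use res in auto)
  have fb: "cmod (f x y z) \<le> norm x * norm y / (\<kappa> * cmod z)"
    if "0 < cmod z" "cmod z < \<delta>" for x y z
  proof -
    have "cmod (f x y z) \<le> norm (resolvent T z x) * norm y"
      unfolding f_def by (rule cmod_cinner_le)
    also have "\<dots> \<le> norm x / (\<kappa> * cmod z) * norm y"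
      using that \<open>\<kappa> > 0\<close> by (intro mult_right_mono resolvent_bound T res below) auto
    finally show ?thesis by simp
  qed
  have near0: "eventually (\<lambda>z::complex. 0 < cmod z \<and> cmod z < \<delta>) (at 0)"
    using eventually_at_ball'[of \<delta> 0 UNIV] \<open>\<delta> > 0\<close> by (auto elim: eventually_mono)
  have gb: "cmod (z * f x y z) \<le> norm x * norm y / \<kappa>"
    if "0 < cmod z" "cmod z < \<delta>" for x y z
    using fb[OF that, of x y] that \<open>\<kappa> > 0\<close> by (simp add: norm_mult field_simps)
  have ex: "\<exists>g. g holomorphic_on ?B \<and> (\<forall>z\<in>?B - {0}. g z = z * f x y z)" for x y
  proof (subst holomorphic_on_extend_bounded)
    show "(\<lambda>z. z * f x y z) holomorphic_on ?B - {0}"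
      by (intro holomorphic_intros hol)
    show "\<exists>B. eventually (\<lambda>z. norm (z * f x y z) \<le> B) (at 0)"
      by (intro exI[of _ "norm x * norm y / \<kappa>"] eventually_mono[OF near0] gb) auto
  qed (use \<open>\<delta> > 0\<close> in auto)
  \<comment> \<open>\<open>g x y\<close> extends \<open>z * f x y z\<close> across 0, so
    \<open>g x y 0\<close> is the residue of the coefficient. It is chosen separately for each pair;
    its dependence on \<open>y\<close> is recovered from uniqueness of the limit
    \<open>lim\<close>.\<close>
  define g where
    "g x y = (SOME g. g holomorphic_on ?B \<and> (\<forall>z\<in>?B - {0}. g z = z * f x y z))" for x y
  have g: "g x y holomorphic_on ?B \<and> (\<forall>z\<in>?B - {0}. g x y z = z * f x y z)" for x y
    unfolding g_def by (rule someI_ex[OF ex])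
  have gh: "g x y holomorphic_on ?B" for x y
    by (rule conjunct1[OF g])
  have gf: "g x y z = z * f x y z" if "z \<in> ?B - {0}" for x y z
    by (rule bspec[OF conjunct2[OF g] that])
  have lim: "((\<lambda>z. z * f x y z) \<longlongrightarrow> g x y 0) (at 0)" for x y
  proof (rule Lim_transform_eventually)
    show "((g x y) \<longlongrightarrow> g x y 0) (at 0)"
      using holomorphic_on_imp_continuous_on[OF gh[of x y]] \<open>\<delta> > 0\<close>
      by (simp add: continuous_on_eq_continuous_at continuous_at)
    show "eventually (\<lambda>z. g x y z = z * f x y z) (at 0)"
      using near0 gf by (auto elim!: eventually_mono)
  qed
  have g0_bound: "cmod (g x y 0) \<le> norm x * norm y / \<kappa>" for x y
    by (rule Lim_norm_ubound[OF _ lim eventually_mono[OF near0]]) (use gb in auto)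
  \<comment> \<open>The residue of the resolvent at \<open>0\<close> has range in the kernel of \<open>T\<close>, hence vanishes.\<close>
  have g0: "Re (g x y 0) = 0" for x y
  proof -
    \<comment> \<open>\<open>g x y 0\<close> is conjugate linear in \<open>y\<close>; its real part
      is a real functional, to which \<open>riesz_representation\<close> applies.\<close>
    have "bounded_linear (\<lambda>y. Re (g x y 0))"
    proof (rule bounded_linear_intro[where K = "norm x / \<kappa>"])
      fix y y' :: 'a and s :: real
      have "((\<lambda>z. z * f x y z + z * f x y' z) \<longlongrightarrow> g x y 0 + g x y' 0) (at 0)"
        by (intro tendsto_intros lim)
      then have "g x (y + y') 0 = g x y 0 + g x y' 0"
        using lim[of x "y + y'"]
        by (intro LIM_unique[OF lim]) (simp_all add: f_def cinner_add_right algebra_simps)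
      then show "Re (g x (y + y') 0) = Re (g x y 0) + Re (g x y' 0)" by simp
      have "((\<lambda>z. of_real s * (z * f x y z)) \<longlongrightarrow> of_real s * g x y 0) (at 0)"
        by (intro tendsto_intros lim)
      then have "g x (s *\<^sub>R y) 0 = of_real s * g x y 0"
        using lim[of x "s *\<^sub>R y"]
        by (intro LIM_unique[OF lim]) (simp_all add: f_def cinner_scaleR_right algebra_simps)
      then show "Re (g x (s *\<^sub>R y) 0) = s *\<^sub>R Re (g x y 0)" by simp
      show "norm (Re (g x y 0)) \<le> norm y * (norm x / \<kappa>)"
        using order_trans[OF abs_Re_le_cmod g0_bound[of x y]] by (simp add: mult.commute)
    qed
    \<comment> \<open>\<open>v\<close> is the weak limit of
      \<open>z *\<^sub>C resolvent T z x\<close> as \<open>z\<close> tends to 0.\<close>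
    then obtain v where v: "\<And>y. Re (g x y 0) = inner y v" using riesz_representation by blast
    have "inner y (T v) = 0" for y
    proof -
      \<comment> \<open>The adjoint moves \<open>T\<close> onto the resolvent, where the resolvent
        equation leaves two terms, each with an extra factor \<open>z\<close> on a convergent
        quantity.\<close>
      have "((\<lambda>z. z * f x (cadjoint T y) z) \<longlongrightarrow> 0) (at 0)"
      proof (rule Lim_transform_eventually)
        have "((\<lambda>z. z * cinner x y + z * (z * f x y z)) \<longlongrightarrow> 0 * cinner x y + 0 * g x y 0) (at 0)"
          by (intro tendsto_intros lim)
        then show "((\<lambda>z. z * cinner x y + z * (z * f x y z)) \<longlongrightarrow> 0) (at 0)" by simp
        show "eventually (\<lambda>z. z * cinner x y + z * (z * f x y z) = z * f x (cadjoint T y) z) (at 0)"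
          using near0
        proof eventually_elim
          case (elim z)
          have "T (resolvent T z x) = x + z *\<^sub>C resolvent T z x"
            using resolvent_right[OF T res, of z x] elim by (simp add: algebra_simps)
          then show ?case
            by (simp add: f_def cinner_add_left cinner_scaleC_left distrib_left
                flip: cinner_cadjoint[OF T])
        qed
      qed
      then have "g x (cadjoint T y) 0 = 0" by (rule LIM_unique[OF lim])
      then have "Re (cinner (cadjoint T y) v) = 0" using v[of "cadjoint T y"] by (simp add: Re_cinner)
      then have "Re (cinner v (cadjoint T y)) = 0" by (subst cinner_commute) simp
      then have "Re (cinner (T v) y) = 0" by (simp add: cinner_cadjoint[OF T])
      then show ?thesis by (simp add: Re_cinner inner_commute)
    qed
    then have "T v = 0" using inner_eq_zero_iff by blast
    then have "v = 0" by (rule inj)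
    then show ?thesis using v by simp
  qed
  have g0': "g x y 0 = 0" for x y
  proof -
    \<comment> \<open>Replacing \<open>y\<close> by \<open>\<i> *\<^sub>C y\<close> multiplies the
      residue by \<open>- \<i>\<close> and so turns its imaginary part into a real part, covered by
      \<open>g0\<close>.\<close>
    have "((\<lambda>z. - \<i> * (z * f x y z)) \<longlongrightarrow> - \<i> * g x y 0) (at 0)"
      by (intro tendsto_intros lim)
    then have "g x (\<i> *\<^sub>C y) 0 = - \<i> * g x y 0"
      using lim[of x "\<i> *\<^sub>C y"]
      by (intro LIM_unique[OF lim]) (simp_all add: f_def cinner_scaleC_right algebra_simps)
    then show ?thesis using g0[of x y] g0[of x "\<i> *\<^sub>C y"] by (simp add: complex_eq_iff)
  qed
  define s where "s = \<delta> / 2"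
  have s: "0 < s" "s < \<delta>" using \<open>\<delta> > 0\<close> by (auto simp: s_def)
  define M where "M = 1 / (\<kappa> * s)"
  have "M > 0" using \<open>\<kappa> > 0\<close> s by (simp add: M_def)
  have fM: "cmod (f x y z) \<le> norm x * norm y * M" if z: "0 < cmod z" "cmod z < s" for x y z
  proof -
    \<comment> \<open>Since \<open>g x y\<close> vanishes at 0, the quotient
      \<open>g x y z / z\<close> extends holomorphically, with the derivative as its value
      there.\<close>
    define F where "F z = (if z = 0 then deriv (g x y) 0 else f x y z)" for z
    have F: "F holomorphic_on ?B"
      by (rule pole_theorem_0[OF gh[of x y], of 0])
        (use \<open>\<delta> > 0\<close> gf g0' in \<open>auto simp: F_def\<close>)
    have "norm (F z) \<le> norm x * norm y * M"
    proof (rule maximum_modulus_frontier[of F "cball 0 s"])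
      show "F holomorphic_on interior (cball 0 s)"
        by (rule holomorphic_on_subset[OF F]) (use s in auto)
      show "continuous_on (closure (cball 0 s)) F"
        by (rule holomorphic_on_imp_continuous_on, rule holomorphic_on_subset[OF F]) (use s in auto)
      show "norm (F w) \<le> norm x * norm y * M" if "w \<in> frontier (cball 0 s)" for w
        using fb[of w x y] that s by (auto simp: F_def M_def)
    qed (use z in auto)
    then show ?thesis using z by (simp add: F_def split: if_splits)
  qed
  \<comment> \<open>Below \<open>s\<close> the bound \<open>fM\<close> applies at \<open>w\<close>;
    below \<open>1 / M\<close> the disc of resolvent points around \<open>w\<close> reaches
    0.\<close>
  define t where "t = min (s / 2) (1 / (2 * M))"
  have t: "0 < t" "t < s" "t < 1 / M" using s \<open>M > 0\<close> by (auto simp: t_def min_def field_simps)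
  define w where "w = complex_of_real t"
  have w: "0 < cmod w" "cmod w < s" "cmod (0 - w) < 1 / M" using t by (auto simp: w_def)
  have wr: "w \<notin> op_spectrum T" using res w s by simp
  have "bdd_below_by (1 / M) T w"
    unfolding bdd_below_by_def
  proof
    fix h
    define x where "x = T h - w *\<^sub>C h"
    have h: "resolvent T w x = h" unfolding x_def by (rule resolvent_left[OF T wr])
    \<comment> \<open>Testing the coefficient at \<open>x\<close> against \<open>y = h\<close>, the
      resolvent image of \<open>x\<close>, produces the squared norm of \<open>h\<close>.\<close>
    have "(norm h)\<^sup>2 \<le> norm x * norm h * M"
      using fM[OF w(1,2), of x h] by (simp add: f_def h cinner_self norm_power)
    then have "norm h * norm h \<le> (norm x * M) * norm h"
      by (simp add: power2_eq_square mult_ac)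
    then have "norm h \<le> norm x * M"
      using \<open>M > 0\<close> by (cases "norm h = 0") (auto simp: mult_le_cancel_right)
    then show "1 / M * norm h \<le> norm (T h - w *\<^sub>C h)"
      using \<open>M > 0\<close> by (simp add: field_simps flip: x_def)
  qed
  then show ?thesis using notin_op_spectrum_perturb[OF T wr] w(3) by blast
qed

section \<open>The set of values and its hull\<close>

definition xi_values :: "real \<Rightarrow> 'a::complex_inner set \<Rightarrow> ('a \<Rightarrow> 'a) \<Rightarrow> complex set"
  where "xi_values \<rho> K T =
    (\<lambda>h. complex_of_real (xi \<rho> T h) * cinner (T h) h) ` xi_dom \<rho> K T"

lemma deformed_range_on_eq: "deformed_range_on \<rho> K T = convex hull (closure (xi_values \<rho> K T))"
  by (simp add: deformed_range_on_def xi_values_def)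

lemma def_r_bounds:
  assumes "1 \<le> \<rho>"
  shows "0 \<le> def_r \<rho>" "def_r \<rho> < 2" "def_r \<rho> = 1 \<longleftrightarrow> \<rho> = 2"
proof -
  have "0 < 1 / \<rho>" "1 / \<rho> \<le> 1" using assms by auto
  then show "0 \<le> def_r \<rho>" "def_r \<rho> < 2" unfolding def_r_def by argo+
  show "def_r \<rho> = 1 \<longleftrightarrow> \<rho> = 2" using assms by (auto simp: def_r_def divide_eq_eq)
qed

lemma xi_dom_norm: "h \<in> xi_dom \<rho> K T \<Longrightarrow> norm h = 1 \<and> h \<in> K"
  by (auto simp: xi_dom_def split: if_splits)

text \<open>With \<open>u\<close> and \<open>t\<close> as in the proof and \<open>u > 0\<close>, the
  modulus is the larger root \<open>(r * u + sqrt D) / 2\<close> of the polynomial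
  \<open>X^2 - r * u * X + (r - 1) * t^2\<close>. At \<open>X = t\<close> the polynomial equals
  \<open>r * t * (t - u)\<close>, which is nonnegative, and \<open>t\<close> lies to the right of
  the vertex \<open>r * u / 2\<close>.\<close>

lemma xi_value_le:
  assumes "1 \<le> \<rho>" and h: "h \<in> xi_dom \<rho> K T"
  shows "cmod (complex_of_real (xi \<rho> T h) * cinner (T h) h) \<le> norm (T h)"
proof (cases "cinner (T h) h = 0")
  case False
  define r where "r = def_r \<rho>"
  define u where "u = cmod (cinner (T h) h)"
  define t where "t = norm (T h)"
  define D where "D = def_Delta \<rho> T h"
  have r: "0 \<le> r" "r < 2" "r = 1 \<longleftrightarrow> \<rho> = 2" using def_r_bounds[OF assms(1)] by (auto simp: r_def)
  have u: "0 < u" using False by (simp add: u_def)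
  have "u \<le> t" unfolding u_def t_def
    using cmod_cinner_le[of "T h" h] xi_dom_norm[OF h] by simp
  have D: "D = r\<^sup>2 * u\<^sup>2 - 4 * (r - 1) * t\<^sup>2"
    by (simp add: D_def def_Delta_def r_def u_def t_def)
  have "T h \<noteq> 0" using False by auto
  \<comment> \<open>For \<open>\<rho> = 2\<close> the domain imposes no sign condition, but then
    \<open>r = 1\<close> and \<open>D\<close> is the square of \<open>u\<close>.\<close>
  then have "D \<ge> 0"
    using h r D by (cases "\<rho> = 2") (auto simp: xi_dom_def D_def)
  have ru: "r * u \<le> 2 * t" using r \<open>u \<le> t\<close> u by (intro mult_mono) auto
  have "sqrt D \<le> 2 * t - r * u"
  proof (rule real_le_lsqrt)
    have "r * t * u \<le> r * t * t" using r \<open>u \<le> t\<close> u by (intro mult_left_mono) auto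
    then show "D \<le> (2 * t - r * u)\<^sup>2" unfolding D by (simp add: power2_eq_square algebra_simps)
  qed (use ru in auto)
  moreover have xi: "xi \<rho> T h = (r + sqrt D / u) / 2"
    using False by (simp add: xi_def r_def u_def D_def)
  have "0 \<le> sqrt D / u" using u \<open>D \<ge> 0\<close> by simp
  then have "0 \<le> xi \<rho> T h" using r(1) unfolding xi by simp
  then have "cmod (complex_of_real (xi \<rho> T h) * cinner (T h) h) = xi \<rho> T h * u"
    by (simp add: norm_mult u_def)
  moreover have "xi \<rho> T h * u = (r * u + sqrt D) / 2"
    using u unfolding xi by (simp add: field_simps)
  ultimately show ?thesis by (simp add: t_def)
qed simp

lemma xi_values_bounded:
  assumes "bounded_clinear T" "1 \<le> \<rho>"
  shows "xi_values \<rho> K T \<subseteq> cball 0 (onorm T)"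
proof
  fix v assume "v \<in> xi_values \<rho> K T"
  then obtain h where h: "h \<in> xi_dom \<rho> K T"
    and v: "v = complex_of_real (xi \<rho> T h) * cinner (T h) h"
    by (auto simp: xi_values_def)
  have "cmod v \<le> norm (T h)" unfolding v by (rule xi_value_le[OF assms(2) h])
  also have "\<dots> \<le> onorm T"
    using onorm[OF bounded_clinear_simps(6)[OF assms(1)], of h] xi_dom_norm[OF h] by simp
  finally show "v \<in> cball 0 (onorm T)" by simp
qed

lemma deformed_range_on_subset_cball:
  assumes "bounded_clinear T" "1 \<le> \<rho>"
  shows "deformed_range_on \<rho> K T \<subseteq> cball 0 (onorm T)"
  unfolding deformed_range_on_eq
  by (rule hull_minimal[where S = convex,
      OF closure_minimal[OF xi_values_bounded[OF assms] closed_cball] convex_cball])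

section \<open>Frontier points of the spectrum as limits of values\<close>

text \<open>Along the approximate eigenvectors, \<open>cinner (T (h n)) (h n)\<close> tends to
  \<open>z\<close> and \<open>norm (T (h n))\<close> to \<open>cmod z\<close>. The discriminant then
  has a positive limit, which puts \<open>h n\<close> into the domain eventually, and the factor
  tends to \<open>(r + (2 - r)) / 2 = 1\<close>.\<close>

lemma approximate_eigenvalue_in_closure:
  fixes T :: "'a::complex_inner \<Rightarrow> 'a"
  assumes "1 \<le> \<rho>" "z \<noteq> 0"
    and h: "\<And>n. norm (h n) = 1" and lim: "(\<lambda>n. T (h n) - z *\<^sub>C h n) \<longlonglongrightarrow> 0"
  shows "z \<in> closure (xi_values \<rho> UNIV T)"
proof -
  define r where "r = def_r \<rho>"
  have r: "0 \<le> r" "r < 2" "r = 1 \<longleftrightarrow> \<rho> = 2" using def_r_bounds[OF assms(1)] by (auto simp: r_def)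
  define w where "w n = cinner (T (h n)) (h n)" for n
  define D where "D n = def_Delta \<rho> T (h n)" for n
  note lim0 = tendsto_norm_zero[OF lim]
  have "(\<lambda>n. w n - z) \<longlonglongrightarrow> 0"
  proof (rule Lim_null_comparison[OF _ lim0])
    have "w n - z = cinner (T (h n) - z *\<^sub>C h n) (h n)" for n
      by (simp add: w_def cinner_diff_left cinner_scaleC_left cinner_self h)
    then show "eventually (\<lambda>n. norm (w n - z) \<le> norm (T (h n) - z *\<^sub>C h n)) sequentially"
      using cmod_cinner_le h by (metis (no_types, lifting) always_eventually mult.right_neutral)
  qed
  then have wl: "w \<longlonglongrightarrow> z" by (rule LIM_zero_cancel)
  have "(\<lambda>n. norm (T (h n)) - cmod z) \<longlonglongrightarrow> 0"
  proof (rule Lim_null_comparison[OF _ lim0])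
    have "norm (norm (T (h n)) - cmod z) \<le> norm (T (h n) - z *\<^sub>C h n)" for n
      using norm_triangle_ineq3[of "T (h n)" "z *\<^sub>C h n"] by (simp add: norm_scaleC h)
    then show "eventually (\<lambda>n. norm (norm (T (h n)) - cmod z) \<le> norm (T (h n) - z *\<^sub>C h n)) sequentially"
      by simp
  qed
  then have tl: "(\<lambda>n. norm (T (h n))) \<longlonglongrightarrow> cmod z" by (rule LIM_zero_cancel)
  have "D \<longlonglongrightarrow> r\<^sup>2 * (cmod z)\<^sup>2 - 4 * (r - 1) * (cmod z)\<^sup>2"
    unfolding D_def def_Delta_def r_def[symmetric] w_def[symmetric]
    by (intro tendsto_intros wl tl)
  also have "r\<^sup>2 * (cmod z)\<^sup>2 - 4 * (r - 1) * (cmod z)\<^sup>2 = ((2 - r) * cmod z)\<^sup>2"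
    by (simp add: power2_eq_square algebra_simps)
  finally have Dl: "D \<longlonglongrightarrow> ((2 - r) * cmod z)\<^sup>2" .
  have evD: "eventually (\<lambda>n. D n > 0) sequentially"
    using order_tendstoD(1)[OF Dl, of 0] r \<open>z \<noteq> 0\<close> by simp
  have evw: "eventually (\<lambda>n. w n \<noteq> 0) sequentially"
    using tendsto_imp_eventually_ne[OF wl \<open>z \<noteq> 0\<close>] .
  define v where "v n = complex_of_real (1 / 2 * (r + sqrt (D n) / cmod (w n))) * w n" for n
  have "v \<longlonglongrightarrow> complex_of_real (1 / 2 * (r + sqrt (((2 - r) * cmod z)\<^sup>2) / cmod z)) * z"
    unfolding v_def by (intro tendsto_intros wl Dl) (use \<open>z \<noteq> 0\<close> in auto)
  also have "1 / 2 * (r + sqrt (((2 - r) * cmod z)\<^sup>2) / cmod z) = 1"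
    using r \<open>z \<noteq> 0\<close> by (simp add: real_sqrt_abs abs_mult)
  finally have "v \<longlonglongrightarrow> z" by simp
  moreover have "eventually (\<lambda>n. v n \<in> closure (xi_values \<rho> UNIV T)) sequentially"
    using evD evw
  proof eventually_elim
    case (elim n)
    then have "h n \<in> xi_dom \<rho> UNIV T" by (simp add: xi_dom_def D_def h)
    moreover have "v n = complex_of_real (xi \<rho> T (h n)) * cinner (T (h n)) (h n)"
      using elim by (simp add: v_def xi_def w_def r_def D_def)
    ultimately have "v n \<in> xi_values \<rho> UNIV T" unfolding xi_values_def by (rule image_eqI[rotated])
    then show ?case using closure_subset by blast
  qed
  ultimately show ?thesis
    using Lim_in_closed_set[OF closed_closure] by (metis sequentially_bot)
qed

lemma not_bdd_below_by_approx:
  assumes T: "bounded_clinear T" and z: "\<not> (\<exists>k>0. bdd_below_by k T z)"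
  obtains h where "\<And>n. norm (h n) = 1" "(\<lambda>n. T (h n) - z *\<^sub>C h n) \<longlonglongrightarrow> 0"
proof -
  note A = bounded_clinear_simps[OF bounded_clinear_shift[OF T, of z]]
  have "\<exists>h. norm h = 1 \<and> norm (T h - z *\<^sub>C h) \<le> inverse (real (Suc n))" for n
  proof -
    obtain x where x: "norm (T x - z *\<^sub>C x) < inverse (real (Suc n)) * norm x"
      using z unfolding bdd_below_by_def
      by (metis inverse_positive_iff_positive of_nat_0_less_iff zero_less_Suc not_le)
    then have x0: "norm x > 0" by (smt (verit) mult_eq_0_iff norm_ge_zero)
    let ?h = "(1 / norm x) *\<^sub>R x"
    have "norm (T ?h - z *\<^sub>C ?h) = norm (T x - z *\<^sub>C x) / norm x"
      unfolding A(5) by simp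
    also have "\<dots> \<le> inverse (real (Suc n))"
      using x x0 by (simp only: pos_divide_le_eq less_imp_le)
    finally show ?thesis using x0 by (intro exI[of _ ?h]) simp
  qed
  then have "\<forall>n. \<exists>h. norm h = 1 \<and> norm (T h - z *\<^sub>C h) \<le> inverse (real (Suc n))" by blast
  from choice[OF this] obtain h where h: "\<And>n. norm (h n) = 1"
      "\<And>n. norm (T (h n) - z *\<^sub>C h n) \<le> inverse (real (Suc n))"
    by blast
  have "(\<lambda>n. T (h n) - z *\<^sub>C h n) \<longlonglongrightarrow> 0"
    by (rule Lim_null_comparison[OF _ LIMSEQ_inverse_real_of_nat]) (use h in auto)
  with h that show ?thesis by blast
qed

text \<open>
  If \<open>0\<close> were not in the closure, unit vectors with small \<open>T h\<close> would satisfy \<open>def_Delta \<rho> T h \<le> 0\<close>,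
  which bounds \<open>cinner (T h) h\<close> away from \<open>norm (T h)\<close> by a fixed factor. Then \<open>0\<close> is an isolated
  point of the spectrum at which the resolvent has at most a simple pole.
\<close>

lemma zero_in_closure:
  fixes T :: "'a::complex_hilbert_space \<Rightarrow> 'a"
  assumes T: "bounded_clinear T" and "1 \<le> \<rho>" and fr: "0 \<in> frontier (op_spectrum T)"
  shows "0 \<in> closure (xi_values \<rho> UNIV T)"
proof (rule ccontr)
  assume "0 \<notin> closure (xi_values \<rho> UNIV T)"
  then obtain \<epsilon> where \<epsilon>: "\<epsilon> > 0" and far: "\<And>v. v \<in> xi_values \<rho> UNIV T \<Longrightarrow> \<epsilon> \<le> cmod v"
    unfolding closure_approachable by (auto simp: not_less)
  note Ts = bounded_clinear_simps[OF T]
  define r where "r = def_r \<rho>"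
  have r: "0 \<le> r" "r < 2" "r = 1 \<longleftrightarrow> \<rho> = 2" using def_r_bounds[OF assms(2)] by (auto simp: r_def)
  \<comment> \<open>A vector of the domain yields a value of modulus at most
    \<open>norm (T h)\<close>, closer to 0 than \<open>far\<close> allows.\<close>
  have dom: "h \<notin> xi_dom \<rho> UNIV T" if "norm (T h) < \<epsilon>" for h
  proof
    assume h: "h \<in> xi_dom \<rho> UNIV T"
    have "\<epsilon> \<le> cmod (complex_of_real (xi \<rho> T h) * cinner (T h) h)"
      by (rule far) (use h in \<open>auto simp: xi_values_def\<close>)
    then show False using xi_value_le[OF assms(2) h] that by linarith
  qed
  have small: "T h \<noteq> 0 \<and> \<rho> \<noteq> 2 \<and> r\<^sup>2 * (cmod (cinner (T h) h))\<^sup>2 \<le> 4 * (r - 1) * (norm (T h))\<^sup>2"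
    if "norm h = 1" "norm (T h) < \<epsilon>" for h
    using dom[OF that(2)] that(1) unfolding xi_dom_def
    by (auto simp: def_Delta_def r_def split: if_splits)
  have inj: "h = 0" if "T h = 0" for h
  proof (rule ccontr)
    assume "h \<noteq> 0"
    then show False using small[of "(1 / norm h) *\<^sub>R h"] that \<epsilon> by (simp add: Ts)
  qed
  obtain h0 where h0: "\<And>n. norm (h0 n) = 1" "(\<lambda>n. T (h0 n) - 0 *\<^sub>C h0 n) \<longlonglongrightarrow> 0"
    using not_bdd_below_by_approx[OF T frontier_op_spectrum_approx[OF T fr]] by blast
  then have "eventually (\<lambda>n. norm (T (h0 n)) < \<epsilon>) sequentially"
    using \<epsilon> by (auto dest!: tendstoD)
  then obtain n where n: "norm (T (h0 n)) < \<epsilon>" using eventually_sequentially by auto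
  \<comment> \<open>The inequality in \<open>small\<close> with \<open>T (h0 n) \<noteq> 0\<close>
    forces \<open>r \<ge> 1\<close>, and \<open>\<rho> \<noteq> 2\<close> excludes equality.\<close>
  have r1: "1 < r"
  proof -
    have "0 \<le> 4 * (r - 1) * (norm (T (h0 n)))\<^sup>2"
      using small[OF h0(1) n] by (smt (verit) zero_le_mult_iff zero_le_power2)
    then show ?thesis using small[OF h0(1) n] r by (auto simp: zero_le_mult_iff)
  qed
  \<comment> \<open>\<open>\<kappa> * cmod z\<close> is the square root of the minimum of
    \<open>t^2 - 2 * cmod z * u + (cmod z)^2\<close> under the constraint
    \<open>r^2 * u^2 \<le> 4 * (r - 1) * t^2\<close>.\<close>
  define \<kappa> where "\<kappa> = (2 - r) / r"
  have \<kappa>: "0 < \<kappa>" "\<kappa> \<le> 1" using r r1 by (auto simp: \<kappa>_def)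
  have below: "bdd_below_by (\<kappa> * cmod z) T z" if z: "cmod z < \<epsilon> / 2" for z
  proof -
    have unit: "\<kappa> * cmod z \<le> norm (T h - z *\<^sub>C h)" if h: "norm h = 1" for h
    proof (cases "norm (T h) < \<epsilon>")
      case True
      define t where "t = norm (T h)"
      define u where "u = cmod (cinner (T h) h)"
      have tu: "r\<^sup>2 * u\<^sup>2 \<le> 4 * (r - 1) * t\<^sup>2" using small[OF h True] by (simp add: t_def u_def)
      have eq: "(norm (T h - z *\<^sub>C h))\<^sup>2 = t\<^sup>2 - 2 * Re (cnj z * cinner (T h) h) + (cmod z)\<^sup>2"
      proof -
        have "(norm (a - b))\<^sup>2 = (norm a)\<^sup>2 - 2 * inner a b + (norm b)\<^sup>2" for a b :: 'a
          by (simp add: power2_norm_eq_inner inner_diff inner_commute)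
        from this[of "T h" "z *\<^sub>C h"] show ?thesis
          by (simp add: t_def norm_scaleC h cinner_scaleC_right flip: Re_cinner)
      qed
      have "Re (cnj z * cinner (T h) h) \<le> cmod z * u"
        using complex_Re_le_cmod[of "cnj z * cinner (T h) h"] by (simp add: norm_mult u_def)
      then have ge: "(norm (T h - z *\<^sub>C h))\<^sup>2 \<ge> t\<^sup>2 - 2 * cmod z * u + (cmod z)\<^sup>2"
        unfolding eq by simp
      have "r\<^sup>2 * (t\<^sup>2 - 2 * cmod z * u + (cmod z)\<^sup>2) - ((2 - r) * cmod z)\<^sup>2 \<ge> 0"
      proof -
        \<comment> \<open>Completing the square in \<open>u\<close>: the factor
          \<open>4 * (r - 1)\<close>, positive by \<open>r1\<close>, clears denominators, and what
          remains is the slack of \<open>tu\<close> plus a square.\<close>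
        have "4 * (r - 1) * (r\<^sup>2 * (t\<^sup>2 - 2 * cmod z * u + (cmod z)\<^sup>2) - ((2 - r) * cmod z)\<^sup>2)
          = r\<^sup>2 * (4 * (r - 1) * t\<^sup>2 - r\<^sup>2 * u\<^sup>2) + (r\<^sup>2 * u - 4 * (r - 1) * cmod z)\<^sup>2"
          by (simp add: power2_eq_square algebra_simps)
        also have "\<dots> \<ge> 0" using tu by simp
        finally show ?thesis using r1 by (simp add: zero_le_mult_iff)
      qed
      then have "((2 - r) * cmod z)\<^sup>2 \<le> r\<^sup>2 * (norm (T h - z *\<^sub>C h))\<^sup>2"
        using mult_left_mono[OF ge, of "r\<^sup>2"] by simp
      then have "((2 - r) * cmod z)\<^sup>2 \<le> (r * norm (T h - z *\<^sub>C h))\<^sup>2"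
        by (simp only: power_mult_distrib)
      then have "(2 - r) * cmod z \<le> r * norm (T h - z *\<^sub>C h)"
        by (rule power2_le_imp_le) (use r in simp)
      then show ?thesis using r1 by (simp add: \<kappa>_def field_simps)
    next
      case False
      \<comment> \<open>Now \<open>norm (T h)\<close> is at least \<epsilon> and exceeds
        \<open>2 * cmod z\<close>, so the triangle inequality alone leaves more than
        \<open>cmod z\<close>.\<close>
      have "norm (T h) \<le> norm (T h - z *\<^sub>C h) + cmod z"
        using norm_triangle_sub[of "T h" "z *\<^sub>C h"] by (simp add: norm_scaleC h add.commute)
      moreover have "\<kappa> * cmod z \<le> cmod z" using \<kappa> by (simp add: mult_left_le_one_le)
      ultimately show ?thesis using False z by linarith
    qed
    note A = bounded_clinear_simps[OF bounded_clinear_shift[OF T, of z]]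
    show ?thesis
      unfolding bdd_below_by_def
    proof
      fix h
      show "\<kappa> * cmod z * norm h \<le> norm (T h - z *\<^sub>C h)"
      proof (cases "h = 0")
        case False
        have "norm (T ((1 / norm h) *\<^sub>R h) - z *\<^sub>C ((1 / norm h) *\<^sub>R h))
            = norm (T h - z *\<^sub>C h) / norm h"
          unfolding A(5) by simp
        moreover have "\<kappa> * cmod z
            \<le> norm (T ((1 / norm h) *\<^sub>R h) - z *\<^sub>C ((1 / norm h) *\<^sub>R h))"
          by (rule unit) (use False in simp)
        ultimately show ?thesis using False by (simp add: pos_le_divide_eq)
      qed simp
    qed
  qed
  have "z \<notin> op_spectrum T" if z: "0 < cmod z" "cmod z < \<epsilon> / 2" for z
  proof
    assume zs: "z \<in> op_spectrum T"
    \<comment> \<open>As 0 is a frontier point, the punctured disc contains resolvent points. A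
      spectral point in it would, by connectedness, force a frontier point there, contradicting the
      lower bound \<open>below\<close>.\<close>
    let ?P = "ball 0 (\<epsilon> / 2) - {0} :: complex set"
    have "0 \<in> op_spectrum T"
      using fr frontier_subset_closed[OF closed_op_spectrum[OF T]] by blast
    have "0 \<in> closure (- op_spectrum T)" using fr unfolding frontier_closures by blast
    then obtain w where "w \<in> - op_spectrum T" "dist w 0 < \<epsilon> / 2"
      using half_gt_zero[OF \<epsilon>] unfolding closure_approachable by blast
    moreover from this have "w \<noteq> 0" using \<open>0 \<in> op_spectrum T\<close> by auto
    ultimately have "?P - op_spectrum T \<noteq> {}" by auto
    moreover have "?P \<inter> op_spectrum T \<noteq> {}" using z zs by auto
    moreover have "connected ?P" by (rule connected_open_delete) auto
    ultimately obtain w where w: "w \<in> ?P" "w \<in> frontier (op_spectrum T)"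
      using connected_Int_frontier by blast
    have "bdd_below_by (\<kappa> * cmod w) T w" "\<kappa> * cmod w > 0" using w(1) \<kappa> by (auto intro!: below)
    then show False using frontier_op_spectrum_approx[OF T w(2)] by blast
  qed
  then have "0 \<notin> op_spectrum T"
    using \<epsilon> \<kappa> below by (intro resolvent_pole_extends[OF T inj \<kappa>(1), of "\<epsilon> / 2"]) auto
  then show False
    using fr frontier_subset_closed[OF closed_op_spectrum[OF T]] by auto
qed

section \<open>From the frontier to the whole spectrum\<close>

text \<open>A point of \<open>S\<close> outside \<open>W\<close> is cut off by a hyperplane. The
  minimum over \<open>S\<close> of the separating functional then also lies beyond the hyperplane,
  so it is attained in the interior of \<open>S\<close>, where a nonzero linear functional has no
  minimum.\<close>

lemma subset_convex_if_frontier_subset: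
  fixes S W :: "'a::euclidean_space set"
  assumes S: "compact S" and W: "convex W" "closed W" and fr: "frontier S \<subseteq> W"
  shows "S \<subseteq> W"
proof
  fix x assume "x \<in> S"
  show "x \<in> W"
  proof (rule ccontr)
    assume "x \<notin> W"
    then obtain a b where ab: "inner a x < b" "\<And>y. y \<in> W \<Longrightarrow> b < inner a y"
      using separating_hyperplane_closed_point[OF W] by blast
    have "continuous_on S (inner a)" by (intro continuous_intros)
    then obtain m where m: "m \<in> S" "\<And>y. y \<in> S \<Longrightarrow> inner a m \<le> inner a y"
      using continuous_attains_inf[OF S, of "inner a"] \<open>x \<in> S\<close> by blast
    have am: "inner a m < b" using m(2)[OF \<open>x \<in> S\<close>] ab(1) by simp
    then have "m \<notin> frontier S" using fr ab(2) by force
    then have "m \<in> interior S" using m(1) by (metis DiffI closure_subset frontier_def subsetD)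
    then obtain e where e: "e > 0" "ball m e \<subseteq> S" using mem_interior by blast
    show False
    proof (cases "a = 0")
      case True
      \<comment> \<open>The functional can vanish only if \<open>W\<close> is empty; the nonempty
        compact \<open>S\<close> still has a frontier point, which would have to lie in
        \<open>W\<close>.\<close>
      have "S \<noteq> UNIV" using S not_compact_UNIV by auto
      then obtain y where "y \<in> frontier S"
        using \<open>x \<in> S\<close> frontier_eq_empty by blast
      then show False using fr ab am True by force
    next
      case False
      let ?y = "m - (e / (2 * norm a)) *\<^sub>R a"
      have "?y \<in> ball m e" using e(1) False by (simp add: dist_norm)
      then have "inner a m \<le> inner a ?y" using e(2) m(2) by blast
      moreover have "e / (2 * norm a) * inner a a > 0" using e(1) False by simp
      ultimately show False by (simp add: inner_diff_right)
    qed
  qed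
qed

lemma op_spectrum_subset_deformed_range:
  fixes T :: "'a::complex_hilbert_space \<Rightarrow> 'a"
  assumes T: "bounded_clinear T" and "1 \<le> \<rho>"
  shows "op_spectrum T \<subseteq> deformed_range \<rho> T"
proof (rule subset_convex_if_frontier_subset[OF compact_op_spectrum[OF T]])
  let ?V = "xi_values \<rho> UNIV T"
  \<comment> \<open>The hull is taken after the closure, so its closedness comes from compactness:
    convex hulls of compact sets in the plane are compact.\<close>
  have "compact (closure ?V)"
    unfolding compact_closure by (rule bounded_subset[OF bounded_cball xi_values_bounded[OF assms]])
  then show "closed (deformed_range \<rho> T)"
    unfolding deformed_range_on_eq by (intro compact_imp_closed compact_convex_hull)
  show "convex (deformed_range \<rho> T)" unfolding deformed_range_on_eq by (rule convex_convex_hull)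
  have "z \<in> closure ?V" if z: "z \<in> frontier (op_spectrum T)" for z
  proof (cases "z = 0")
    case True
    then show ?thesis using zero_in_closure[OF assms] z by simp
  next
    case False
    obtain h where "\<And>n. norm (h n) = 1" "(\<lambda>n. T (h n) - z *\<^sub>C h n) \<longlonglongrightarrow> 0"
      using not_bdd_below_by_approx[OF T frontier_op_spectrum_approx[OF T z]] by blast
    then show ?thesis by (rule approximate_eigenvalue_in_closure[OF assms(2) False])
  qed
  then have "frontier (op_spectrum T) \<subseteq> closure ?V" by (rule subsetI)
  also have "\<dots> \<subseteq> deformed_range \<rho> T" unfolding deformed_range_on_eq by (rule hull_subset)
  finally show "frontier (op_spectrum T) \<subseteq> deformed_range \<rho> T" .
qed

section \<open>Self-adjointness, unitary equivalence, scaling and restriction\<close>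

lemma deformed_range_self_adjoint:
  fixes T :: "'a::complex_hilbert_space \<Rightarrow> 'a"
  assumes T: "bounded_clinear T" and sa: "T = cadjoint T"
  shows "deformed_range \<rho> T \<subseteq> \<real>"
proof -
  have "cnj (cinner (T h) h) = cinner (T h) h" for h
    using cinner_cadjoint[OF T, of h h] sa by (metis cinner_commute)
  then have "cinner (T h) h \<in> \<real>" for h by (simp add: Reals_cnj_iff)
  then have "xi_values \<rho> UNIV T \<subseteq> \<real>" by (auto simp: xi_values_def)
  moreover have "convex (\<real> :: complex set)"
    by (auto simp: complex_is_Real_iff convex_def)
  ultimately show ?thesis
    unfolding deformed_range_on_eq by (intro hull_minimal closure_minimal closed_complex_Reals)
qed

text \<open>All ingredients of the value of \<open>?S\<close> at \<open>h\<close> agree with those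
  of \<open>T\<close> at \<open>U h\<close>, and \<open>U\<close> maps the unit sphere onto
  itself.\<close>

lemma deformed_range_unitary:
  fixes T :: "'a::complex_hilbert_space \<Rightarrow> 'a"
  assumes U: "unitary_op U"
  shows "deformed_range \<rho> (cadjoint U \<circ> T \<circ> U) = deformed_range \<rho> T"
proof -
  have bU: "bounded_clinear U" and AU: "\<And>x. cadjoint U (U x) = x" and UA: "\<And>x. U (cadjoint U x) = x"
    using U by (auto simp: unitary_op_def fun_eq_iff)
  let ?S = "cadjoint U \<circ> T \<circ> U"
  have ci: "cinner (U x) (U y) = cinner x y" for x y
    by (simp add: cinner_cadjoint[OF bU] AU)
  have norm_eq: "norm x = norm y" if "cinner x x = cinner y y" for x y :: 'a
    using that unfolding cinner_self of_real_eq_iff by simp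
  have nU: "norm (U x) = norm x" for x by (rule norm_eq[OF ci])
  have nA: "norm (cadjoint U x) = norm x" for x using nU[of "cadjoint U x"] UA by simp
  have S: "cinner (?S h) h = cinner (T (U h)) (U h)" "norm (?S h) = norm (T (U h))" for h
    using ci[of "?S h" h] by (simp_all add: UA nA)
  then have z: "?S h = 0 \<longleftrightarrow> T (U h) = 0" for h by (metis norm_eq_zero)
  have xi: "xi \<rho> ?S h = xi \<rho> T (U h)" for h
    unfolding xi_def def_Delta_def S ..
  have dom: "h \<in> xi_dom \<rho> UNIV ?S \<longleftrightarrow> U h \<in> xi_dom \<rho> UNIV T" for h
    unfolding xi_dom_def def_Delta_def using nU z S by simp
  have "xi_values \<rho> UNIV ?S = xi_values \<rho> UNIV T"
  proof (intro equalityI subsetI)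
    fix v assume "v \<in> xi_values \<rho> UNIV ?S"
    then show "v \<in> xi_values \<rho> UNIV T" unfolding xi_values_def using dom xi S by auto
  next
    fix v assume "v \<in> xi_values \<rho> UNIV T"
    then obtain h where h: "h \<in> xi_dom \<rho> UNIV T" "v = complex_of_real (xi \<rho> T h) * cinner (T h) h"
      by (auto simp: xi_values_def)
    then have "cadjoint U h \<in> xi_dom \<rho> UNIV ?S" using dom[of "cadjoint U h"] UA by simp
    moreover have "v = complex_of_real (xi \<rho> ?S (cadjoint U h)) * cinner (?S (cadjoint U h)) (cadjoint U h)"
      unfolding xi S(1) UA by (rule h(2))
    ultimately show "v \<in> xi_values \<rho> UNIV ?S" unfolding xi_values_def by blast
  qed
  then show ?thesis by (simp add: deformed_range_on_eq)
qed

text \<open>The discriminant scales by the square of \<open>cmod \<alpha>\<close>, so its root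
  divided by \<open>cmod (cinner (T h) h)\<close> is invariant and the domain is unchanged. For
  \<open>\<alpha> = 0\<close> this breaks down, as every unit vector of \<open>K\<close> then enters
  the domain.\<close>

lemma deformed_range_on_scaleC:
  assumes \<alpha>: "\<alpha> \<noteq> 0"
  shows "deformed_range_on \<rho> K (\<lambda>x. \<alpha> *\<^sub>C T x) = (\<lambda>z. \<alpha> * z) ` deformed_range_on \<rho> K T"
proof -
  let ?S = "\<lambda>x. \<alpha> *\<^sub>C T x"
  have D: "def_Delta \<rho> ?S h = (cmod \<alpha>)\<^sup>2 * def_Delta \<rho> T h" for h
    by (simp add: def_Delta_def cinner_scaleC_left norm_mult norm_scaleC power_mult_distrib
        algebra_simps)
  have z: "\<alpha> *\<^sub>C T h = 0 \<longleftrightarrow> T h = 0" for h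
    using \<alpha> by (metis norm_scaleC norm_eq_zero mult_eq_0_iff)
  have "xi_dom \<rho> K ?S = xi_dom \<rho> K T"
    unfolding xi_dom_def D z using \<alpha> by (simp add: zero_less_mult_iff)
  moreover have "xi \<rho> ?S h = xi \<rho> T h" for h
    unfolding xi_def D using \<alpha> by (simp add: cinner_scaleC_left norm_mult real_sqrt_mult)
  ultimately have V: "xi_values \<rho> K ?S = (\<lambda>z. \<alpha> * z) ` xi_values \<rho> K T"
    by (simp add: xi_values_def image_image cinner_scaleC_left mult_ac)
  have lin: "linear (\<lambda>z. \<alpha> * z)" by (simp add: bounded_linear.linear bounded_linear_mult_right)
  have inj: "inj (\<lambda>z. \<alpha> * z)" using \<alpha> by (simp add: inj_def)
  show ?thesis
    unfolding deformed_range_on_eq V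
    by (simp add: convex_hull_linear_image[OF lin] closure_injective_linear_image[OF lin inj])
qed

lemma deformed_range_zero:
  assumes "(UNIV :: 'a::complex_inner set) \<noteq> {0}"
  shows "deformed_range \<rho> (\<lambda>x. 0 :: 'a) = {0}"
proof -
  obtain x :: 'a where "x \<noteq> 0" using assms by auto
  then have "norm ((1 / norm x) *\<^sub>R x) = 1" by simp
  then have "(1 / norm x) *\<^sub>R x \<in> xi_dom \<rho> UNIV (\<lambda>x. 0 :: 'a)" by (simp add: xi_dom_def)
  then have "xi_values \<rho> UNIV (\<lambda>x. 0 :: 'a) = {0}" unfolding xi_values_def by auto
  then show ?thesis by (simp add: deformed_range_on_eq)
qed

text \<open>Domain and values at \<open>h\<close> involve the operator only through its value at
  \<open>h\<close>, and the domain lies in \<open>K\<close>; the default value of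
  \<open>restrict\<close> off \<open>K\<close> is never seen.\<close>

lemma deformed_range_on_restrict_subset:
  "deformed_range_on \<rho> K (restrict T K) \<subseteq> deformed_range \<rho> T"
proof -
  have "xi \<rho> (restrict T K) h = xi \<rho> T h" if "h \<in> K" for h
    using that by (simp add: xi_def def_Delta_def)
  moreover have "xi_dom \<rho> K (restrict T K) \<subseteq> xi_dom \<rho> UNIV T"
    by (auto simp: xi_dom_def def_Delta_def)
  ultimately have "xi_values \<rho> K (restrict T K) \<subseteq> xi_values \<rho> UNIV T"
    unfolding xi_values_def using xi_dom_norm by (fastforce simp: image_iff)
  then show ?thesis unfolding deformed_range_on_eq by (intro hull_mono closure_mono)
qed

theorem theorem2:
  fixes T :: "'a::complex_hilbert_space \<Rightarrow> 'a" and \<rho> :: real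
  assumes "(UNIV :: 'a set) \<noteq> {0}"
    and "bounded_clinear T"
    and "1 \<le> \<rho>"
  shows "(T = cadjoint T \<longrightarrow> deformed_range \<rho> T \<subseteq> \<real>)
    \<and> (\<forall>U. unitary_op U \<longrightarrow>
         deformed_range \<rho> (cadjoint U \<circ> T \<circ> U) = deformed_range \<rho> T)
    \<and> (\<forall>\<alpha>. deformed_range \<rho> (\<lambda>x. \<alpha> *\<^sub>C T x) = (\<lambda>z. \<alpha> * z) ` deformed_range \<rho> T)
    \<and> (\<forall>K. csubspace K \<and> closed K \<and> K \<noteq> {0} \<and> T ` K \<subseteq> K \<longrightarrow>
         deformed_range_on \<rho> K (restrict T K) \<subseteq> deformed_range \<rho> T)
    \<and> deformed_range \<rho> T \<subseteq> (\<lambda>z. complex_of_real (onorm T) * z) ` cball 0 1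
    \<and> op_spectrum T \<subseteq> deformed_range \<rho> T"
proof (intro conjI impI allI)
  show "deformed_range \<rho> T \<subseteq> \<real>" if "T = cadjoint T"
    by (rule deformed_range_self_adjoint[OF assms(2) that])
  show "deformed_range \<rho> (cadjoint U \<circ> T \<circ> U) = deformed_range \<rho> T" if "unitary_op U" for U
    by (rule deformed_range_unitary[OF that])
  show spec: "op_spectrum T \<subseteq> deformed_range \<rho> T"
    by (rule op_spectrum_subset_deformed_range[OF assms(2,3)])
  show "deformed_range \<rho> (\<lambda>x. \<alpha> *\<^sub>C T x) = (\<lambda>z. \<alpha> * z) ` deformed_range \<rho> T" for \<alpha>
  proof (cases "\<alpha> = 0")
    case True
    \<comment> \<open>For \<open>\<rho> > 2\<close>, that \<open>deformed_range \<rho> T\<close> is nonempty rests on the spectrum being nonempty.\<close>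
    have "deformed_range \<rho> T \<noteq> {}" using spec op_spectrum_nonempty[OF assms(2,1)] by blast
    then show ?thesis using True deformed_range_zero[OF assms(1)] by auto
  qed (rule deformed_range_on_scaleC)
  show "deformed_range_on \<rho> K (restrict T K) \<subseteq> deformed_range \<rho> T" for K
    by (rule deformed_range_on_restrict_subset)
  show "deformed_range \<rho> T \<subseteq> (\<lambda>z. complex_of_real (onorm T) * z) ` cball 0 1"
  proof
    fix v assume "v \<in> deformed_range \<rho> T"
    then have v: "cmod v \<le> onorm T"
      using deformed_range_on_subset_cball[OF assms(2,3)] by (auto simp: subset_iff)
    show "v \<in> (\<lambda>z. complex_of_real (onorm T) * z) ` cball 0 1"
    proof (cases "onorm T = 0")
      case True
      \<comment> \<open>Here \<open>v = 0\<close>, and dividing by \<open>onorm T\<close> would not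
        give a preimage in general form; 0 itself serves.\<close>
      then show ?thesis using v by (auto intro!: image_eqI[of _ _ 0])
    next
      case False
      then show ?thesis
        using v by (intro image_eqI[of _ _ "v / onorm T"])
          (auto simp: norm_divide divide_le_eq intro: order_trans[OF norm_ge_zero])
    qed
  qed
qed

end
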